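(* Let $A\in\mathbb R^{M_3\times N}$ be the matrix defined in the context. Given $R=(R_1;R_2;R_3)\in\mathbb R^{M}\times\mathbb R^M\times\mathbb R^{M-1}$, the solution $y=(y_1;y_2;y_3)\in\mathbb R^M\times\mathbb R^M\times\mathbb R^{M-1}$ of $AA^\top y=R$ is given, in terms of the blocks $y_i=(y_i^1;\dots;y_i^n)$, $R_i=(R_i^1;\dots;R_i^n)$ described in the context, by $$y_2^j=\tfrac1m\big(R_2^j-(\mathbf 1_m^\top y_1^j)\mathbf 1_m\big),\quad j=1,\dots,n,$$ $$y_3^j=\tfrac1n\Big(R_3^j+\sum_{s=1}^n y_1^s\Big),\quad j=1,\dots,n-1,\qquad y_3^n=\tfrac1n\Big(R_3^n+\bar I_m\sum_{s=1}^n y_1^s\Big),$$ $$y_1^j=\hat y_1^j-\hat y_1^a,\quad j=1,\dots,n,$$ where: (1) $\hat y_1^j=\frac1{m+n}\big(\tilde R_1^j+\tilde R_2^j+\tilde R_3\big)$, $j=1,\dots,n$, with $\tilde R_1^j=R_1^j+\frac1n(\mathbf 1_m^\top R_1^j)\mathbf 1_m$, $\tilde R_2^j=-\big(\frac1m+\frac1n\big)(\mathbf 1_m^\top R_2^j)\mathbf 1_m$, and $\tilde R_3=\frac1n\big(\sum_{s=1}^{n-1}R_3^s+\bar I_m^\top R_3^n\big)+\frac1{n^2}(\mathbf 1_{M-1}^\top R_3)\mathbf 1_m$; (2) $\hat y_1^a=\big(I_m+\frac1n\mathbf 1_m\mathbf 1_m^\top\big)\hat W\sum_{s=1}^n\hat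 y_1^s$; (3) $\hat W=-\operatorname{diag}\big(\frac1mI_{m-1},\frac1{m+1}(1-\frac1n)\big)-\frac1w dd^\top$, with $d=\big[\frac1m\mathbf 1_{m-1};\frac1{m+1}(1-\frac1n)\big]\in\mathbb R^m$ and $w=\frac1m-\frac1{m+1}\big(1-\frac1n\big)$.
   Context: Let $m,n$ be positive integers, $M=mn$, $M_3=3M-1$, $N=m^2n+mn^2$. $\mathbf 1_p$ is the all-ones vector in $\mathbb R^p$, $I_p$ the identity, $\otimes$ the Kronecker product, and $\bar I_p=[I_{p-1},\mathbf 0_{p-1}]\in\mathbb R^{(p-1)\times p}$. Define $A=\begin{bmatrix} A_1 & A_2 \\ A_3 & \mathbf 0 \\ \mathbf 0 & A_4 \end{bmatrix}\in\mathbb R^{M_3\times N}$ with $A_1=I_M\otimes\mathbf 1_m^\top\in\mathbb R^{M\times m^2n}$, $A_2=-\mathbf 1_n^\top\otimes I_M\in\mathbb R^{M\times mn^2}$, $A_3=I_n\otimes(\mathbf 1_m^\top\otimes I_m)\in\mathbb R^{M\times m^2n}$, and $A_4=\operatorname{diag}(\mathbf 1_n^\top\otimes I_m,\dots,\mathbf 1_n^\top\otimes I_m,\mathbf 1_n^\top\otimes\bar I_m)\in\mathbb R^{(M-1)\times mn^2}$ (block diagonal with $n$ blocks). The matrix $A$ has full row rank. Block notation: for $i=1,2$, $y_i=(y_i^1;\dots;y_i^n)$ and $R_i=(R_i^1;\dots;R_i^n)$ with all blocks in $\mathbb R^m$; $y_3=(y_3^1;\dots;y_3^n)$ and $R_3=(R_3^1;\dots;R_3^n)$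 with the first $n-1$ blocks in $\mathbb R^m$ and the last block in $\mathbb R^{m-1}$. *)

theory Defs
  imports Complex_Main "Jordan_Normal_Form.Matrix"
begin

section \<open>General matrix and vector notation\<close>

definition ones_vec :: "nat \<Rightarrow> real vec" where
  "ones_vec p = vec p (\<lambda>_. 1)"

definition outer_prod :: "real vec \<Rightarrow> real vec \<Rightarrow> real mat" where
  "outer_prod u v = mat (dim_vec u) (dim_vec v) (\<lambda>(i, j). u $ i * v $ j)"

definition kronecker :: "real mat \<Rightarrow> real mat \<Rightarrow> real mat" (infixr \<open>\<otimes>\<^sub>K\<close> 75) where
  "A \<otimes>\<^sub>K B = mat (dim_row A * dim_row B) (dim_col A * dim_col B)
     (\<lambda>(i, j). A $$ (i div dim_row B, j div dim_col B) * B $$ (i mod dim_row B, j mod dim_col B))"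

text \<open>The matrix \<open>[I, 0]\<close> with \<open>p - 1\<close> rows and \<open>p\<close> columns.\<close>
definition Ibar :: "nat \<Rightarrow> real mat" where
  "Ibar p = mat (p - 1) p (\<lambda>(i, j). if i = j then 1 else 0)"

text \<open>Block number \<open>j\<close>, counted from 0, of a vector cut into consecutive blocks of length \<open>m\<close>.
  The \<open>min\<close> makes the last block shorter if the vector ends early: a vector of dimension
  \<open>m * n - 1\<close> has \<open>n - 1\<close> blocks of length \<open>m\<close> and a last one of length \<open>m - 1\<close>.\<close>
definition block :: "nat \<Rightarrow> real vec \<Rightarrow> nat \<Rightarrow> real vec" where
  "block m v j = vec (min m (dim_vec v - m * j)) (\<lambda>i. v $ (m * j + i))"

section \<open>The constraint matrix\<close>

definition A1 :: "nat \<Rightarrow> nat \<Rightarrow> real mat" where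
  "A1 m n = 1\<^sub>m (m * n) \<otimes>\<^sub>K mat_of_row (ones_vec m)"

definition A2 :: "nat \<Rightarrow> nat \<Rightarrow> real mat" where
  "A2 m n = - mat_of_row (ones_vec n) \<otimes>\<^sub>K 1\<^sub>m (m * n)"

definition A3 :: "nat \<Rightarrow> nat \<Rightarrow> real mat" where
  "A3 m n = 1\<^sub>m n \<otimes>\<^sub>K (mat_of_row (ones_vec m) \<otimes>\<^sub>K 1\<^sub>m m)"

definition A4 :: "nat \<Rightarrow> nat \<Rightarrow> real mat" where
  "A4 m n = diag_block_mat
     (replicate (n - 1) (mat_of_row (ones_vec n) \<otimes>\<^sub>K 1\<^sub>m m) @ [mat_of_row (ones_vec n) \<otimes>\<^sub>K Ibar m])"

definition constraint_mat :: "nat \<Rightarrow> nat \<Rightarrow> real mat" where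
  "constraint_mat m n =
     four_block_mat (A1 m n) (A2 m n)
       (A3 m n @\<^sub>r 0\<^sub>m (m * n - 1) (m\<^sup>2 * n)) (0\<^sub>m (m * n) (m * n\<^sup>2) @\<^sub>r A4 m n)"

lemma constraint_mat_carrier:
  assumes "m > 0" "n > 0"
  shows "A1 m n \<in> carrier_mat (m * n) (m\<^sup>2 * n)"
    and "A2 m n \<in> carrier_mat (m * n) (m * n\<^sup>2)"
    and "A3 m n \<in> carrier_mat (m * n) (m\<^sup>2 * n)"
    and "A4 m n \<in> carrier_mat (m * n - 1) (m * n\<^sup>2)"
    and "constraint_mat m n \<in> carrier_mat (3 * (m * n) - 1) (m\<^sup>2 * n + m * n\<^sup>2)"
proof -
  note dims = kronecker_def mat_of_row_def ones_vec_def Ibar_def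
  have dr: "dim_row (A4 m n) = (n - 1) * m + (m - 1)"
    by (simp add: A4_def dim_diag_block_mat dims sum_list_replicate)
  moreover have "(n - 1) * m + (m - 1) = m * n - 1"
    using assms by (cases m; cases n) (auto simp: algebra_simps)
  ultimately have r4: "dim_row (A4 m n) = m * n - 1" by simp
  have "dim_col (A4 m n) = (n - 1) * (n * m) + n * m"
    by (simp add: A4_def dim_diag_block_mat dims sum_list_replicate)
  also have "\<dots> = m * n\<^sup>2"
    using assms by (cases n) (auto simp: algebra_simps power2_eq_square)
  finally have c4: "dim_col (A4 m n) = m * n\<^sup>2" .
  show c: "A1 m n \<in> carrier_mat (m * n) (m\<^sup>2 * n)"
    "A2 m n \<in> carrier_mat (m * n) (m * n\<^sup>2)"
    "A3 m n \<in> carrier_mat (m * n) (m\<^sup>2 * n)"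
    "A4 m n \<in> carrier_mat (m * n - 1) (m * n\<^sup>2)"
    using r4 c4 by (auto simp: A1_def A2_def A3_def dims power2_eq_square)
  have "m * n > 0" using assms by simp
  then show "constraint_mat m n \<in> carrier_mat (3 * (m * n) - 1) (m\<^sup>2 * n + m * n\<^sup>2)"
    using c by (auto simp: constraint_mat_def append_rows_def)
qed

section \<open>The quantities entering the closed form of the solution\<close>

definition Rtilde1 :: "nat \<Rightarrow> nat \<Rightarrow> real vec \<Rightarrow> nat \<Rightarrow> real vec" where
  "Rtilde1 m n R1 j = block m R1 j + (1 / real n * (ones_vec m \<bullet> block m R1 j)) \<cdot>\<^sub>v ones_vec m"

definition Rtilde2 :: "nat \<Rightarrow> nat \<Rightarrow> real vec \<Rightarrow> nat \<Rightarrow> real vec" where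
  "Rtilde2 m n R2 j =
     (- (1 / real m + 1 / real n) * (ones_vec m \<bullet> block m R2 j)) \<cdot>\<^sub>v ones_vec m"

definition Rtilde3 :: "nat \<Rightarrow> nat \<Rightarrow> real vec \<Rightarrow> real vec" where
  "Rtilde3 m n R3 =
     (1 / real n) \<cdot>\<^sub>v (finsum_vec TYPE(real) m (block m R3) {..<n - 1}
                      + transpose_mat (Ibar m) *\<^sub>v block m R3 (n - 1))
     + (1 / (real n)\<^sup>2 * (ones_vec (m * n - 1) \<bullet> R3)) \<cdot>\<^sub>v ones_vec m"

definition yhat1 :: "nat \<Rightarrow> nat \<Rightarrow> real vec \<Rightarrow> real vec \<Rightarrow> real vec \<Rightarrow> nat \<Rightarrow> real vec" where
  "yhat1 m n R1 R2 R3 j =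
     (1 / (real m + real n)) \<cdot>\<^sub>v (Rtilde1 m n R1 j + Rtilde2 m n R2 j + Rtilde3 m n R3)"

definition d_last :: "nat \<Rightarrow> nat \<Rightarrow> real" where
  "d_last m n = 1 / (real m + 1) * (1 - 1 / real n)"

definition d_vec :: "nat \<Rightarrow> nat \<Rightarrow> real vec" where
  "d_vec m n = (1 / real m) \<cdot>\<^sub>v ones_vec (m - 1) @\<^sub>v vec 1 (\<lambda>_. d_last m n)"

definition w :: "nat \<Rightarrow> nat \<Rightarrow> real" where
  "w m n = 1 / real m - 1 / (real m + 1) * (1 - 1 / real n)"

definition What :: "nat \<Rightarrow> nat \<Rightarrow> real mat" where
  "What m n =
     - diag_block_mat [(1 / real m) \<cdot>\<^sub>m 1\<^sub>m (m - 1), mat 1 1 (\<lambda>_. d_last m n)]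
     - (1 / w m n) \<cdot>\<^sub>m outer_prod (d_vec m n) (d_vec m n)"

definition yhat1_a :: "nat \<Rightarrow> nat \<Rightarrow> real vec \<Rightarrow> real vec \<Rightarrow> real vec \<Rightarrow> real vec" where
  "yhat1_a m n R1 R2 R3 =
     (1\<^sub>m m + (1 / real n) \<cdot>\<^sub>m outer_prod (ones_vec m) (ones_vec m))
       *\<^sub>v (What m n *\<^sub>v finsum_vec TYPE(real) m (yhat1 m n R1 R2 R3) {..<n})"

end

theory Submission
  imports Defs
begin

text \<open>Written blockwise, the second and third groups of equations of \<open>A A\<^sup>T y = R\<close> express \<open>y\<^sub>2\<close> and
  \<open>y\<^sub>3\<close> through \<open>y\<^sub>1\<close>. Substituting them into the first group leaves, for every block \<open>j\<close>,
  \<open>((m + n) I - 1 1\<^sup>T) y\<^sub>1\<^sup>j - D \<Sum>\<^sub>s y\<^sub>1\<^sup>s = b\<^sup>j\<close> with \<open>D = diag (1, \<dots>, 1, 1 - 1 / n)\<close>. The blocks are thus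
  coupled only through their sum, whose equation is diagonal plus rank one and so is solved
  explicitly; this yields the matrix \<open>W\<close> of the closed form.\<close>

text \<open>The last block of \<open>y3\<close> is one entry short, so the last coordinate of the
  sum of its blocks receives only n - 1 of the n copies of S / n, where S is the sum of the blocks
  of \<open>y1\<close>. This is the origin of the entry 1 - 1 / n of D. With \<theta> for the
  entries of D, solving the summed equation produces \<delta> = \<theta> / (m + n - n \<theta>),
  that is 1 / m for \<theta> = 1 and (1 - 1 / n) / (m + 1) for \<theta> = 1 - 1 / n: the entries of
  d. The rank-one part contributes the pivot 1 - \<Sum> \<delta>, which equals w. Had the last row
  of \<open>A4\<close> been kept, D would be the identity, every \<delta> would be 1 / m and the
  pivot would vanish; dropping that row is what makes the system uniquely solvable. All steps are
  equivalences between entrywise equations. Existence and uniqueness both come out of the closed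
  form, since it determines \<open>y1\<close> from R alone and \<open>y2\<close>, \<open>y3\<close>
  from \<open>y1\<close>.\<close>

section \<open>Flat indices as pairs of block number and offset\<close>

lemma sum_lessThan_mult:
  fixes f :: "nat \<Rightarrow> real"
  shows "(\<Sum>c<a * b. f c) = (\<Sum>j<b. \<Sum>i<a. f (a * j + i))"
proof -
  have "(\<Sum>c<a * b. f c) = (\<Sum>j<b. sum f {j * a..<j * a + a})"
    using sum.nat_group[of f a b] by (simp add: mult.commute)
  also have "\<dots> = (\<Sum>j<b. \<Sum>i<a. f (a * j + i))"
  proof (rule sum.cong[OF refl])
    fix j
    show "sum f {j * a..<j * a + a} = (\<Sum>i<a. f (a * j + i))"
      using sum.shift_bounds_nat_ivl[of f 0 "j * a" a] by (simp add: lessThan_atLeast0 ac_simps)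
  qed
  finally show ?thesis .
qed

lemma less_mult_index:
  fixes m n j i :: nat
  assumes "j < n" "i < m"
  shows "m * j + i < m * n"
proof -
  have "m * j + i < m * (j + 1)" using assms(2) by simp
  also have "\<dots> \<le> m * n" using assms(1) by (intro mult_left_mono) auto
  finally show ?thesis .
qed

lemma mult_index_cases:
  fixes m n r :: nat
  assumes "r < m * n"
  obtains j i where "j < n" "i < m" "r = m * j + i"
proof
  show "r div m < n" using assms by (simp add: less_mult_imp_div_less mult.commute)
  show "r mod m < m" using assms by (cases m) auto
  show "r = m * (r div m) + r mod m" by simp
qed

lemma mult_index_eq_iff:
  fixes m j i j' i' :: nat
  assumes "i < m" "i' < m"
  shows "m * j + i = m * j' + i' \<longleftrightarrow> j = j' \<and> i = i'"
proof
  assume "m * j + i = m * j' + i'"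
  then have "(m * j + i) div m = (m * j' + i') div m" "(m * j + i) mod m = (m * j' + i') mod m"
    by simp_all
  then show "j = j' \<and> i = i'" using assms by simp
qed simp

lemma sum_kronecker_delta2:
  fixes f :: "nat \<Rightarrow> nat \<Rightarrow> real"
  assumes "j < n" "i < m"
  shows "(\<Sum>j'<n. \<Sum>i'<m. if j' = j \<and> i' = i then f j' i' else 0) = f j i"
proof -
  have "(\<Sum>j'<n. \<Sum>i'<m. if j' = j \<and> i' = i then f j' i' else 0)
      = (\<Sum>j'<n. if j' = j then (\<Sum>i'<m. if i' = i then f j' i' else 0) else 0)"
    by (intro sum.cong refl) auto
  also have "\<dots> = f j i" using assms by simp
  finally show ?thesis .
qed

section \<open>The blocks of the constraint matrix\<close>

text \<open>Only the last block may be shorter, so block number k still begins at row k p and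
  \<open>r div p\<close> names the right block for every row. The induction removes the leading
  \<open>B\<close>, which lowers both quotients by one.\<close>

lemma diag_block_mat_replicate_index:
  assumes "B \<in> carrier_mat p q" "C \<in> carrier_mat p' q" "p' \<le> p"
    and "r < k * p + p'" "c < k * q + q"
  shows "diag_block_mat (replicate k B @ [C]) $$ (r, c) =
    (if r div p = c div q then (if r div p < k then B else C) $$ (r mod p, c mod q) else 0)"
  using assms(4,5)
proof (induction k arbitrary: r c)
  case 0
  then have "c div q = 0" "c mod q = c" by auto
  moreover have "r div p = 0 \<and> r mod p = r"
    using 0 assms(3) 
    by auto
  ultimately show ?case by (simp del: diag_block_mat.simps)
next
  case (Suc k)
  let ?D = "diag_block_mat (replicate k B @ [C])"
  have D: "dim_row ?D = k * p + p'" "dim_col ?D = k * q + q"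
    using assms(1,2) by (simp_all add: dim_diag_block_mat sum_list_replicate)
  have p: "p > 0" using Suc.prems assms(3) by (cases p) auto
  have q: "q > 0" using Suc.prems by (cases q) auto
  have eq: "diag_block_mat (replicate (Suc k) B @ [C]) $$ (r, c) =
    (if r < p then if c < q then B $$ (r, c) else 0
     else if c < q then 0 else ?D $$ (r - p, c - q))"
    using Suc.prems D assms(1) by (simp add: Let_def)
  consider "r < p" "c < q" | "r < p" "\<not> c < q" | "\<not> r < p" "c < q" | "\<not> r < p" "\<not> c < q"
    by blast
  then show ?case
  proof cases
    case 4
    then have "?D $$ (r - p, c - q) = (if (r - p) div p = (c - q) div q
      then (if (r - p) div p < k then B else C) $$ ((r - p) mod p, (c - q) mod q) else 0)"
      using Suc.prems by (intro Suc.IH) auto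
    with 4 p q show ?thesis
      unfolding eq by (simp add: le_div_geq le_mod_geq)
  qed (use p q in \<open>unfold eq, auto simp: div_eq_0_iff dest: sym\<close>)
qed

text \<open>Read column c as m (m j + k) + i with j < n and k, i < m: the columns form n square
  arrays indexed by (k, i). Then \<open>c div m\<close> is m j + k, so a row of \<open>A1\<close>
  sums over i with j and k fixed, whereas a row of \<open>A3\<close> sums over k with j and i
  fixed.\<close>

lemma A1_index:
  assumes "r < m * n" "c < m\<^sup>2 * n"
  shows "A1 m n $$ (r, c) = (if c div m = r then 1 else 0)"
proof -
  have "c div m < m * n"
    using assms(2) by (simp add: less_mult_imp_div_less power2_eq_square mult_ac)
  moreover from this have "c mod m < m" by (intro mod_less_divisor) (cases m, auto)
  ultimately show ?thesis
    using assms unfolding A1_def kronecker_def mat_of_row_def ones_vec_def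
    by (auto simp: power2_eq_square mult_ac)
qed

text \<open>Here column c is m (n j + s) + i with j, s < n and i < m. Its residue modulo m n is m s
  + i, so a row of \<open>A2\<close> sums over j with s and i fixed, whereas a row of
  \<open>A4\<close> sums over s with j and i fixed.\<close>

lemma A2_index:
  assumes "r < m * n" "c < m * n\<^sup>2"
  shows "A2 m n $$ (r, c) = (if c mod (m * n) = r then - 1 else 0)"
proof -
  have "c div (m * n) < n"
    using assms(2) by (simp add: less_mult_imp_div_less power2_eq_square mult_ac)
  moreover have "c mod (m * n) < m * n" using assms(1) by (intro mod_less_divisor) linarith
  ultimately show ?thesis
    using assms unfolding A2_def kronecker_def mat_of_row_def ones_vec_def
    by (auto simp: power2_eq_square mult_ac)
qed

text \<open>The Kronecker factors test block number and offset separately. Both tests are merged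
  into one equation because the general facts on products expect a target row computed from the
  column.\<close>

lemma A3_index:
  assumes "r < m * n" "c < m\<^sup>2 * n"
  shows "A3 m n $$ (r, c) = (if m * (c div m\<^sup>2) + c mod m = r then 1 else 0)"
proof -
  have m: "m > 0" using assms by (cases m) auto
  have c: "c div (m * m) < n"
    using assms(2) by (simp add: less_mult_imp_div_less power2_eq_square mult_ac)
  have r: "r div m < n" using assms(1) by (simp add: less_mult_imp_div_less mult.commute)
  have cm: "c mod (m * m) div m < m"
    using m by (simp add: less_mult_imp_div_less)
  have cmm: "c mod (m * m) mod m = c mod m" by (simp add: mod_mod_cancel)
  have "A3 m n $$ (r, c) = (if r div m = c div (m * m) \<and> r mod m = c mod m then 1 else 0)"
    using assms m c r cm cmm unfolding A3_def kronecker_def mat_of_row_def ones_vec_def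
    by (auto simp: power2_eq_square mult_ac)
  moreover have "m * (c div m\<^sup>2) + c mod m = m * (r div m) + r mod m \<longleftrightarrow>
      c div m\<^sup>2 = r div m \<and> c mod m = r mod m"
    using m by (intro mult_index_eq_iff) auto
  ultimately show ?thesis by (auto simp: power2_eq_square)
qed

text \<open>The formula is that of the matrix with its last row retained. Columns with target m n -
  1 match no admissible row and are therefore zero.\<close>

lemma A4_index:
  assumes "n > 0" "r < m * n - 1" "c < m * n\<^sup>2"
  shows "A4 m n $$ (r, c) = (if m * (c div (m * n)) + c mod m = r then 1 else 0)"
proof -
  have m: "m > 0" using assms by (cases m) auto
  let ?B = "mat_of_row (ones_vec n) \<otimes>\<^sub>K 1\<^sub>m m" and ?C = "mat_of_row (ones_vec n) \<otimes>\<^sub>K Ibar m"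
  have rn: "(n - 1) * m + (m - 1) = m * n - 1"
    using m assms(1) by (cases n; cases m) (auto simp: algebra_simps)
  have cn: "(n - 1) * (m * n) + m * n = m * n\<^sup>2"
    using assms(1) by (cases n) (auto simp: algebra_simps power2_eq_square)
  have "A4 m n $$ (r, c) = (if r div m = c div (m * n)
      then (if r div m < n - 1 then ?B else ?C) $$ (r mod m, c mod (m * n)) else 0)"
    unfolding A4_def
    by (rule diag_block_mat_replicate_index[where p' = "m - 1"])
      (use assms rn cn in \<open>auto simp: kronecker_def mat_of_row_def ones_vec_def Ibar_def mult_ac\<close>)
  moreover have "(if r div m < n - 1 then ?B else ?C) $$ (r mod m, c mod (m * n))
      = (if r mod m = c mod m then 1 else 0)"
  proof -
    have cm: "c mod (m * n) < m * n" using assms m by (simp add: mod_less_divisor)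
    then have cd: "c mod (m * n) div m < n" by (simp add: less_mult_imp_div_less mult.commute)
    have cmm: "c mod (m * n) mod m = c mod m" by (simp add: mod_mod_cancel)
    \<comment> \<open>\<open>Ibar\<close> agrees with the identity on its m - 1 rows; the bound on r
      keeps the offset within them in the last block.\<close>
    have "r mod m < m - 1" if "\<not> r div m < n - 1"
    proof -
      have "m * (n - 1) \<le> m * (r div m)" using that by (intro mult_left_mono) auto
      moreover have "m * (r div m) + r mod m = r" by simp
      ultimately show ?thesis using rn[unfolded mult.commute[of "n - 1"]] assms(2) by linarith
    qed
    then show ?thesis
      using cm cd cmm m
      by (auto simp: kronecker_def mat_of_row_def ones_vec_def Ibar_def mult_ac)
  qed
  moreover have "m * (c div (m * n)) + c mod m = m * (r div m) + r mod m \<longleftrightarrow>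
      c div (m * n) = r div m \<and> c mod m = r mod m"
    using m by (intro mult_index_eq_iff) auto
  ultimately show ?thesis by auto
qed

text \<open>Each block has at most one nonzero entry per column, in row \<open>\<phi> c\<close>.\<close>

lemma selector_mat_mult_vec_index:
  fixes B :: "real mat"
  assumes "B \<in> carrier_mat nr nc" "x \<in> carrier_vec nc" "r < nr"
    and "\<And>c. c < nc \<Longrightarrow> B $$ (r, c) = (if \<phi> c = r then s else 0)"
  shows "(B *\<^sub>v x) $ r = (\<Sum>c<nc. if \<phi> c = r then s * x $ c else 0)"
  using assms by (auto simp: scalar_prod_def lessThan_atLeast0 intro!: sum.cong)

text \<open>Column c has its only possible nonzero entry in row t, so the transpose copies that
  entry of y. A target outside the range is allowed: it occurs for the zero columns of
  \<open>A4\<close> and is the reason for padding \<open>y3\<close> with zero.\<close>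

lemma selector_mat_transpose_mult_vec_index:
  fixes B :: "real mat"
  assumes "B \<in> carrier_mat nr nc" "y \<in> carrier_vec nr" "c < nc"
    and "\<And>r. r < nr \<Longrightarrow> B $$ (r, c) = (if t = r then s else 0)"
  shows "(transpose_mat B *\<^sub>v y) $ c = (if t < nr then s * y $ t else 0)"
proof -
  have "(transpose_mat B *\<^sub>v y) $ c = (\<Sum>r<nr. B $$ (r, c) * y $ r)"
    using assms(1-3) by (auto simp: scalar_prod_def lessThan_atLeast0)
  also have "\<dots> = (\<Sum>r<nr. if t = r then s * y $ r else 0)"
    using assms(4) by (intro sum.cong refl) auto
  also have "\<dots> = (if t < nr then s * y $ t else 0)" by simp
  finally show ?thesis .
qed

section \<open>Products of the four blocks with a vector, entry by entry\<close>

context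
  fixes m n :: nat
  assumes pos: "m > 0" "n > 0"
begin

lemma A1_mult_vec_index:
  assumes "x \<in> carrier_vec (m\<^sup>2 * n)" "j < n" "i < m"
  shows "(A1 m n *\<^sub>v x) $ (m * j + i) = (\<Sum>k<m. x $ (m * (m * j + i) + k))"
proof -
  have r: "m * j + i < m * n" using assms less_mult_index by simp
  have "(A1 m n *\<^sub>v x) $ (m * j + i) = (\<Sum>c<m * (m * n). if c div m = m * j + i then 1 * x $ c else 0)"
    using selector_mat_mult_vec_index[OF constraint_mat_carrier(1)[OF pos] assms(1) r A1_index[OF r]]
    by (simp add: power2_eq_square mult_ac)
  also have "\<dots> = (\<Sum>r'<m * n. if r' = m * j + i then \<Sum>k<m. x $ (m * r' + k) else 0)"
    unfolding sum_lessThan_mult by (intro sum.cong refl) (auto intro!: sum.cong)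
  finally show ?thesis using r by simp
qed

lemma A2_mult_vec_index:
  assumes "x \<in> carrier_vec (m * n\<^sup>2)" "r < m * n"
  shows "(A2 m n *\<^sub>v x) $ r = - (\<Sum>s<n. x $ (m * n * s + r))"
proof -
  have "(A2 m n *\<^sub>v x) $ r = (\<Sum>c<(m * n) * n. if c mod (m * n) = r then - 1 * x $ c else 0)"
    using selector_mat_mult_vec_index[OF constraint_mat_carrier(2)[OF pos] assms A2_index[OF assms(2)]]
    by (simp add: power2_eq_square mult_ac)
  also have "\<dots> = (\<Sum>s<n. \<Sum>r'<m * n. if r' = r then - x $ (m * n * s + r') else 0)"
    unfolding sum_lessThan_mult[of _ "m * n"] by (intro sum.cong refl) auto
  also have "\<dots> = - (\<Sum>s<n. x $ (m * n * s + r))" using assms by (simp add: sum_negf)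
  finally show ?thesis .
qed

lemma A3_mult_vec_index:
  assumes "x \<in> carrier_vec (m\<^sup>2 * n)" "j < n" "i < m"
  shows "(A3 m n *\<^sub>v x) $ (m * j + i) = (\<Sum>k<m. x $ (m * (m * j + k) + i))"
proof -
  have r: "m * j + i < m * n" using assms less_mult_index by simp
  have d: "(m * (m * j' + k) + i') div m\<^sup>2 = j'" if "k < m" "i' < m" for j' k i' :: nat
    using that by (simp add: power2_eq_square div_mult2_eq)
  have "(A3 m n *\<^sub>v x) $ (m * j + i)
      = (\<Sum>c<m * (m * n). if m * (c div m\<^sup>2) + c mod m = m * j + i then 1 * x $ c else 0)"
    using selector_mat_mult_vec_index[OF constraint_mat_carrier(3)[OF pos] assms(1) r A3_index[OF r]]
    by (simp add: power2_eq_square mult_ac)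
  also have "\<dots> = (\<Sum>j'<n. \<Sum>k<m. \<Sum>i'<m.
      if j' = j \<and> i' = i then x $ (m * (m * j' + k) + i') else 0)"
    unfolding sum_lessThan_mult
    by (intro sum.cong refl) (auto simp: d mult_index_eq_iff assms)
  \<comment> \<open>The condition fixes j' and i' but leaves the middle index k free, so the sum
    over k moves outside before the other two collapse.\<close>
  also have "\<dots> = (\<Sum>k<m. \<Sum>j'<n. \<Sum>i'<m.
      if j' = j \<and> i' = i then x $ (m * (m * j' + k) + i') else 0)"
    by (rule sum.swap)
  finally show ?thesis using assms by (simp add: sum_kronecker_delta2)
qed

lemma A4_mult_vec_index:
  assumes "x \<in> carrier_vec (m * n\<^sup>2)" "j < n" "i < m" "m * j + i < m * n - 1"
  shows "(A4 m n *\<^sub>v x) $ (m * j + i) = (\<Sum>s<n. x $ (m * (n * j + s) + i))"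
proof -
  note r = assms(4)
  have d: "(m * (n * j' + s) + i') div (m * n) = j'" if "s < n" "i' < m" for j' s i' :: nat
    using that by (simp add: div_mult2_eq)
  have "(A4 m n *\<^sub>v x) $ (m * j + i)
      = (\<Sum>c<m * (n * n). if m * (c div (m * n)) + c mod m = m * j + i then 1 * x $ c else 0)"
    using selector_mat_mult_vec_index[OF constraint_mat_carrier(4)[OF pos] assms(1) r A4_index[OF pos(2) r]]
    by (simp add: power2_eq_square mult_ac)
  also have "\<dots> = (\<Sum>j'<n. \<Sum>s<n. \<Sum>i'<m.
      if j' = j \<and> i' = i then x $ (m * (n * j' + s) + i') else 0)"
    unfolding sum_lessThan_mult
    by (intro sum.cong refl) (auto simp: d mult_index_eq_iff assms)
  also have "\<dots> = (\<Sum>s<n. \<Sum>j'<n. \<Sum>i'<m.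
      if j' = j \<and> i' = i then x $ (m * (n * j' + s) + i') else 0)"
    by (rule sum.swap)
  finally show ?thesis using assms by (simp add: sum_kronecker_delta2)
qed

end

section \<open>The normal equations\<close>

text \<open>\<open>append_rows\<close> is a four-block matrix whose right blocks have no columns.
  Transposing makes them blocks without rows, which contribute a vector of dimension 0.\<close>

lemma transpose_append_rows_mult_vec:
  fixes P Q :: "real mat"
  assumes "P \<in> carrier_mat k nc" "Q \<in> carrier_mat l nc" "a \<in> carrier_vec k" "b \<in> carrier_vec l"
  shows "transpose_mat (P @\<^sub>r Q) *\<^sub>v (a @\<^sub>v b) = transpose_mat P *\<^sub>v a + transpose_mat Q *\<^sub>v b"
proof -
  have "transpose_mat (P @\<^sub>r Q) =
      four_block_mat (transpose_mat P) (transpose_mat Q) (0\<^sub>m 0 k) (0\<^sub>m 0 l)"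
    using assms unfolding append_rows_def
    by (subst transpose_four_block_mat[where ?nr1.0 = k and ?nc1.0 = nc and ?nr2.0 = l and ?nc2.0 = 0]) auto
  also have "\<dots> *\<^sub>v (a @\<^sub>v b) =
      (transpose_mat P *\<^sub>v a + transpose_mat Q *\<^sub>v b) @\<^sub>v (0\<^sub>m 0 k *\<^sub>v a + 0\<^sub>m 0 l *\<^sub>v b)"
    using assms
    by (intro four_block_mat_mult_vec[where ?nr1.0 = nc and ?nr2.0 = 0]) auto
  also have "\<dots> = transpose_mat P *\<^sub>v a + transpose_mat Q *\<^sub>v b"
    by (intro eq_vecI) auto
  finally show ?thesis .
qed

lemma vec_eq_iff_blocks:
  assumes "v \<in> carrier_vec p" "v' \<in> carrier_vec p" "p \<le> m * n"
  shows "v = v' \<longleftrightarrow> (\<forall>j<n. \<forall>i<m. m * j + i < p \<longrightarrow> v $ (m * j + i) = v' $ (m * j + i))"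
proof
  assume eq: "\<forall>j<n. \<forall>i<m. m * j + i < p \<longrightarrow> v $ (m * j + i) = v' $ (m * j + i)"
  show "v = v'"
  proof (rule eq_vecI)
    fix r assume "r < dim_vec v'"
    then have r: "r < p" "r < m * n" using assms by auto
    obtain j i where "j < n" "i < m" "r = m * j + i" using r(2) by (rule mult_index_cases)
    then show "v $ r = v' $ r" using eq r by simp
  qed (use assms in auto)
qed simp

text \<open>Zero-padding makes the short last block of \<open>R\<^sub>3\<close> and \<open>y\<^sub>3\<close> as long as the others;
  on that block it is multiplication by the transpose of \<open>[I, 0]\<close>.\<close>
definition zero_pad :: "real vec \<Rightarrow> nat \<Rightarrow> real" where
  "zero_pad v r = (if r < dim_vec v then v $ r else 0)"

context
  fixes m n :: nat
  assumes pos: "m > 0" "n > 0"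
begin

text \<open>The vector x = \<open>A\<^sup>T y\<close> is computed before A is applied, so the
  entries of the product matrix are never described. At (j, k, i) in the first group of columns x is
  y1(j, k) + y2(j, i); at (j, s, i) in the second it is y3(j, i) - y1(s, i). Each row of a block
  sums over one index, and a term independent of that index picks up a factor m or n;
  \<open>y1\<close> collects m from \<open>A1\<close> and n from \<open>A2\<close>.\<close>

lemma normal_equations:
  assumes y: "y1 \<in> carrier_vec (m * n)" "y2 \<in> carrier_vec (m * n)" "y3 \<in> carrier_vec (m * n - 1)"
    and R: "R1 \<in> carrier_vec (m * n)" "R2 \<in> carrier_vec (m * n)" "R3 \<in> carrier_vec (m * n - 1)"
  shows "(constraint_mat m n * transpose_mat (constraint_mat m n)) *\<^sub>v (y1 @\<^sub>v y2 @\<^sub>v y3)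
      = R1 @\<^sub>v R2 @\<^sub>v R3 \<longleftrightarrow>
    (\<forall>j<n. \<forall>i<m. (m + n) * y1 $ (m * j + i) + (\<Sum>k<m. y2 $ (m * j + k))
        - (\<Sum>s<n. zero_pad y3 (m * s + i)) = R1 $ (m * j + i)) \<and>
    (\<forall>j<n. \<forall>i<m. (\<Sum>k<m. y1 $ (m * j + k)) + m * y2 $ (m * j + i) = R2 $ (m * j + i)) \<and>
    (\<forall>j<n. \<forall>i<m. m * j + i < m * n - 1 \<longrightarrow>
        n * y3 $ (m * j + i) - (\<Sum>s<n. y1 $ (m * s + i)) = R3 $ (m * j + i))"
proof -
  let ?A = "constraint_mat m n"
  note A = constraint_mat_carrier[OF pos]
  define xa where "xa = transpose_mat (A1 m n) *\<^sub>v y1 + transpose_mat (A3 m n) *\<^sub>v y2"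
  define xb where "xb = transpose_mat (A2 m n) *\<^sub>v y1 + transpose_mat (A4 m n) *\<^sub>v y3"
  have xa_carrier: "xa \<in> carrier_vec (m\<^sup>2 * n)" and xb_carrier: "xb \<in> carrier_vec (m * n\<^sup>2)"
    using A y by (auto simp: xa_def xb_def)
  have T0: "transpose_mat (0\<^sub>m k l) *\<^sub>v v = 0\<^sub>v l" if "v \<in> carrier_vec k" for k l and v :: "real vec"
    using that by (intro eq_vecI) auto
  have C: "A3 m n @\<^sub>r 0\<^sub>m (m * n - 1) (m\<^sup>2 * n) \<in> carrier_mat (m * n + (m * n - 1)) (m\<^sup>2 * n)"
    "0\<^sub>m (m * n) (m * n\<^sup>2) @\<^sub>r A4 m n \<in> carrier_mat (m * n + (m * n - 1)) (m * n\<^sup>2)"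
    using A by auto
  have "transpose_mat ?A *\<^sub>v (y1 @\<^sub>v y2 @\<^sub>v y3) = xa @\<^sub>v xb"
  proof -
    have "transpose_mat ?A *\<^sub>v (y1 @\<^sub>v y2 @\<^sub>v y3) =
      (transpose_mat (A1 m n) *\<^sub>v y1
        + transpose_mat (A3 m n @\<^sub>r 0\<^sub>m (m * n - 1) (m\<^sup>2 * n)) *\<^sub>v (y2 @\<^sub>v y3)) @\<^sub>v
      (transpose_mat (A2 m n) *\<^sub>v y1
        + transpose_mat (0\<^sub>m (m * n) (m * n\<^sup>2) @\<^sub>r A4 m n) *\<^sub>v (y2 @\<^sub>v y3))"
      unfolding constraint_mat_def transpose_four_block_mat[OF A(1,2) C]
      using A C y by (intro four_block_mat_mult_vec) auto
    also have "transpose_mat (A3 m n @\<^sub>r 0\<^sub>m (m * n - 1) (m\<^sup>2 * n)) *\<^sub>v (y2 @\<^sub>v y3)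
        = transpose_mat (A3 m n) *\<^sub>v y2"
      using A y by (subst transpose_append_rows_mult_vec[OF A(3) zero_carrier_mat y(2,3)])
        (simp add: T0 del: zero_transpose_mat)
    also have "transpose_mat (0\<^sub>m (m * n) (m * n\<^sup>2) @\<^sub>r A4 m n) *\<^sub>v (y2 @\<^sub>v y3)
        = transpose_mat (A4 m n) *\<^sub>v y3"
      using A y by (subst transpose_append_rows_mult_vec[OF zero_carrier_mat A(4) y(2,3)])
        (simp add: T0 del: zero_transpose_mat)
    finally show ?thesis by (simp add: xa_def xb_def)
  qed
  moreover have "y1 @\<^sub>v y2 @\<^sub>v y3 \<in> carrier_vec (3 * (m * n) - 1)"
  proof -
    have "m * n + (m * n + (m * n - 1)) = 3 * (m * n) - 1"
      using pos nat_0_less_mult_iff[of m n] by linarith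
    then show ?thesis by (metis append_carrier_vec y)
  qed
  ultimately have "(?A * transpose_mat ?A) *\<^sub>v (y1 @\<^sub>v y2 @\<^sub>v y3) = ?A *\<^sub>v (xa @\<^sub>v xb)"
    using assoc_mult_mat_vec[OF A(5) transpose_carrier_mat[THEN iffD2, OF A(5)]] by simp
  also have "\<dots> = (A1 m n *\<^sub>v xa + A2 m n *\<^sub>v xb) @\<^sub>v
      ((A3 m n @\<^sub>r 0\<^sub>m (m * n - 1) (m\<^sup>2 * n)) *\<^sub>v xa + (0\<^sub>m (m * n) (m * n\<^sup>2) @\<^sub>r A4 m n) *\<^sub>v xb)"
    unfolding constraint_mat_def
    by (rule four_block_mat_mult_vec[OF A(1,2) C xa_carrier xb_carrier])
  also have "(A3 m n @\<^sub>r 0\<^sub>m (m * n - 1) (m\<^sup>2 * n)) *\<^sub>v xa + (0\<^sub>m (m * n) (m * n\<^sup>2) @\<^sub>r A4 m n) *\<^sub>v xb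
      = A3 m n *\<^sub>v xa @\<^sub>v A4 m n *\<^sub>v xb"
    unfolding mat_mult_append[OF A(3) zero_carrier_mat xa_carrier]
      mat_mult_append[OF zero_carrier_mat A(4) xb_carrier]
    using A xa_carrier xb_carrier by (intro eq_vecI) auto
  finally have prod: "(?A * transpose_mat ?A) *\<^sub>v (y1 @\<^sub>v y2 @\<^sub>v y3) =
      (A1 m n *\<^sub>v xa + A2 m n *\<^sub>v xb) @\<^sub>v A3 m n *\<^sub>v xa @\<^sub>v A4 m n *\<^sub>v xb" .
  have xa: "xa $ (m * (m * j + k) + i) = y1 $ (m * j + k) + y2 $ (m * j + i)"
    if "j < n" "k < m" "i < m" for j k i
  proof -
    let ?c = "m * (m * j + k) + i"
    have c: "?c < m\<^sup>2 * n"
      using less_mult_index[OF less_mult_index[OF that(1,2)] that(3)] by (simp add: power2_eq_square)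
    have "?c div m\<^sup>2 = j" using that by (simp add: power2_eq_square div_mult2_eq)
    then show ?thesis
      using selector_mat_transpose_mult_vec_index[OF A(1) y(1) c A1_index[OF _ c]]
        selector_mat_transpose_mult_vec_index[OF A(3) y(2) c A3_index[OF _ c]] A c that
      by (simp add: xa_def less_mult_index)
  qed
  \<comment> \<open>At j = n - 1, i = m - 1 the target row of \<open>A4\<close> is the omitted one,
    and the padding supplies the value 0. The minus sign is that of \<open>A2\<close>.\<close>
  have xb: "xb $ (m * (n * j + s) + i) = zero_pad y3 (m * j + i) - y1 $ (m * s + i)"
    if "j < n" "s < n" "i < m" for j s i
  proof -
    let ?c = "m * (n * j + s) + i"
    have c: "?c < m * n\<^sup>2"
      using less_mult_index[OF less_mult_index[OF that(1,2)] that(3)] by (simp add: power2_eq_square)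
    have "m * s + i < m * n" using that by (intro less_mult_index) auto
    moreover have "?c = m * n * j + (m * s + i)" by (simp add: algebra_simps)
    ultimately have "?c mod (m * n) = m * s + i" by (metis mod_less mod_mult_self4)
    moreover have "?c div (m * n) = j" using that by (simp add: div_mult2_eq)
    ultimately show ?thesis
      using selector_mat_transpose_mult_vec_index[OF A(2) y(1) c A2_index[OF _ c]]
        selector_mat_transpose_mult_vec_index[OF A(4) y(3) c A4_index[OF pos(2) _ c]] A c y(3) that
      by (simp add: xb_def zero_pad_def less_mult_index)
  qed
  have row1: "(A1 m n *\<^sub>v xa + A2 m n *\<^sub>v xb) $ (m * j + i) =
      (m + n) * y1 $ (m * j + i) + (\<Sum>k<m. y2 $ (m * j + k)) - (\<Sum>s<n. zero_pad y3 (m * s + i))"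
    if "j < n" "i < m" for j i
  proof -
    \<comment> \<open>A row of \<open>A2\<close> fixes the two inner indices and sums over the
      outermost, so s and j exchange the roles they have in the formula for
      \<open>xb\<close>.\<close>
    have "xb $ (m * n * s + (m * j + i)) = zero_pad y3 (m * s + i) - y1 $ (m * j + i)" if "s < n" for s
      using xb[OF \<open>s < n\<close> \<open>j < n\<close> \<open>i < m\<close>] by (simp add: algebra_simps)
    then have "(A2 m n *\<^sub>v xb) $ (m * j + i) = n * y1 $ (m * j + i) - (\<Sum>s<n. zero_pad y3 (m * s + i))"
      using A2_mult_vec_index[OF pos xb_carrier less_mult_index[OF that]]
      by (simp add: sum_subtractf)
    moreover have "(A1 m n *\<^sub>v xa) $ (m * j + i) = m * y1 $ (m * j + i) + (\<Sum>k<m. y2 $ (m * j + k))"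
      using A1_mult_vec_index[OF pos xa_carrier that] xa that by (simp add: sum.distrib)
    ultimately show ?thesis
      using A less_mult_index[OF that] by (simp add: algebra_simps)
  qed
  have row2: "(A3 m n *\<^sub>v xa) $ (m * j + i) = (\<Sum>k<m. y1 $ (m * j + k)) + m * y2 $ (m * j + i)"
    if "j < n" "i < m" for j i
    using A3_mult_vec_index[OF pos xa_carrier that] xa that by (simp add: sum.distrib)
  have row3: "(A4 m n *\<^sub>v xb) $ (m * j + i) = n * y3 $ (m * j + i) - (\<Sum>s<n. y1 $ (m * s + i))"
    if "j < n" "i < m" "m * j + i < m * n - 1" for j i
    using A4_mult_vec_index[OF pos xb_carrier that] xb that y(3) by (simp add: sum_subtractf zero_pad_def)
  have carriers: "A1 m n *\<^sub>v xa + A2 m n *\<^sub>v xb \<in> carrier_vec (m * n)"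
    "A3 m n *\<^sub>v xa \<in> carrier_vec (m * n)" "A4 m n *\<^sub>v xb \<in> carrier_vec (m * n - 1)"
    using A xa_carrier xb_carrier by auto
  show ?thesis
    unfolding prod append_vec_eq[OF carriers(1) R(1)] append_vec_eq[OF carriers(2) R(2)]
      vec_eq_iff_blocks[OF carriers(1) R(1) order_refl] vec_eq_iff_blocks[OF carriers(2) R(2) order_refl]
      vec_eq_iff_blocks[OF carriers(3) R(3) diff_le_self]
    by (simp add: row1 row2 row3 less_mult_index cong: conj_cong)
qed

end

section \<open>Blocks coupled through their sum\<close>

text \<open>Solves the equation that remains for \<open>y\<^sub>1\<close> after \<open>y\<^sub>2\<close> and \<open>y\<^sub>3\<close> are eliminated.
  Its coefficient matrix is \<open>(m + n) I - 1 1\<^sup>T\<close> on each block, with inverse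
  \<open>(I + 1 1\<^sup>T / n) / (m + n)\<close>, minus \<open>diag \<theta>\<close> applied to the sum of the blocks;
  \<open>\<theta> = (m + n) \<delta> / (1 + n \<delta>)\<close> is \<open>1\<close> except for a last entry \<open>1 - 1 / n\<close>.\<close>

lemma coupled_blocks_solution:
  fixes y b yh :: "nat \<Rightarrow> nat \<Rightarrow> real" and \<delta> \<theta> :: "nat \<Rightarrow> real" and W :: real and m n :: nat
  assumes pos: "m > 0" "n > 0" and \<delta>0: "\<And>i. \<delta> i \<ge> 0"
    and \<theta>: "\<And>i. \<theta> i * (1 + n * \<delta> i) = (m + n) * \<delta> i"
    and sum_\<delta>: "(\<Sum>i<m. \<delta> i) = 1 - W" and W: "W \<noteq> 0"
    and yh: "\<And>j i. yh j i = (b j i + (\<Sum>k<m. b j k) / n) / (m + n)"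
  defines "v \<equiv> \<lambda>i. \<Sum>j<n. yh j i"
  defines "q \<equiv> \<Sum>i<m. \<delta> i * v i"
  defines "u \<equiv> \<lambda>i. - \<delta> i * (v i + q / W)"
  shows "(\<forall>j<n. \<forall>i<m. (m + n) * y j i - (\<Sum>k<m. y j k) - \<theta> i * (\<Sum>s<n. y s i) = b j i) \<longleftrightarrow>
    (\<forall>j<n. \<forall>i<m. y j i = yh j i - (u i + (\<Sum>k<m. u k) / n))"
proof
  have mn: "real m + real n > 0" "real n > 0" using pos by auto
  have den: "1 + n * \<delta> i > 0" for i using \<delta>0[of i] by (simp add: add_pos_nonneg)
  have sum_u: "(\<Sum>i<m. u i) = - q / W"
  proof -
    have "(\<Sum>i<m. u i) = - (\<Sum>i<m. \<delta> i * v i) - (\<Sum>i<m. \<delta> i) * (q / W)"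
      unfolding u_def sum_distrib_right sum_negf[symmetric] sum_subtractf[symmetric]
      by (intro sum.cong refl) (simp add: ring_distribs)
    then show ?thesis using W by (simp add: sum_\<delta> field_simps flip: q_def)
  qed
  {
    assume eq: "\<forall>j<n. \<forall>i<m. (m + n) * y j i - (\<Sum>k<m. y j k) - \<theta> i * (\<Sum>s<n. y s i) = b j i"
    \<comment> \<open>With the coupling term t frozen, every block is a separate system with
      right-hand side b + t; solving it leaves t and its total \<open>\<tau>\<close> as the only
      unknowns.\<close>
    define t where "t i = \<theta> i * (\<Sum>s<n. y s i)" for i
    define \<tau> where "\<tau> = (\<Sum>i<m. t i)"
    have y: "y j i = yh j i + (t i + \<tau> / n) / (m + n)" if "j < n" "i < m" for j i
    proof -
      have b: "b j k = (m + n) * y j k - (\<Sum>k<m. y j k) - t k" if "k < m" for k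
        using eq \<open>j < n\<close> that by (simp add: t_def)
      have "(\<Sum>k<m. b j k) = (m + n) * (\<Sum>k<m. y j k) - m * (\<Sum>k<m. y j k) - \<tau>"
        by (simp add: b sum_subtractf \<tau>_def sum_distrib_left)
      then have "(\<Sum>k<m. b j k) = n * (\<Sum>k<m. y j k) - \<tau>" by (simp add: algebra_simps)
      then have "(\<Sum>k<m. y j k) = (\<Sum>k<m. b j k) / n + \<tau> / n"
        using mn by (simp add: field_simps)
      then have "(m + n) * y j i = (b j i + (\<Sum>k<m. b j k) / n) + (t i + \<tau> / n)"
        using b[OF that(2)] by simp
      then show ?thesis
        using mn by (simp add: yh add_divide_distrib[symmetric] eq_divide_eq mult.commute)
    qed
    have S: "(\<Sum>s<n. y s i) = (1 + n * \<delta> i) * (v i + \<tau> / (m + n))" if "i < m" for i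
    proof -
      have "(\<Sum>s<n. y s i) = (\<Sum>s<n. yh s i + (t i + \<tau> / n) / (m + n))"
        using y that by (intro sum.cong refl) auto
      also have "\<dots> = v i + n * (t i + \<tau> / n) / (m + n)"
        by (simp add: v_def sum.distrib)
      also have "n * (t i + \<tau> / n) = n * t i + \<tau>"
        using mn by (simp add: distrib_left)
      finally have S: "(\<Sum>s<n. y s i) = v i + (n * t i + \<tau>) / (m + n)" .
      \<comment> \<open>Replacing \<theta> by \<delta> puts n \<delta> S on both sides, where S is
        the sum of the blocks, and it cancels. This avoids dividing by \<theta>, whose last entry is
        0 in the application when n = 1.\<close>
      have "t i * (1 + n * \<delta> i) = (m + n) * \<delta> i * (\<Sum>s<n. y s i)"
        using \<theta>[of i] by (metis t_def mult.assoc mult.commute)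
      then have "n * (t i * (1 + n * \<delta> i)) / (m + n) = n * \<delta> i * (\<Sum>s<n. y s i)"
        using mn by simp
      moreover have "(\<Sum>s<n. y s i) * (1 + n * \<delta> i)
          = (v i + \<tau> / (m + n)) * (1 + n * \<delta> i) + n * (t i * (1 + n * \<delta> i)) / (m + n)"
        by (subst S) (simp add: add_divide_distrib ring_distribs)
      ultimately have "(\<Sum>s<n. y s i) * (1 + n * \<delta> i)
          = (v i + \<tau> / (m + n)) * (1 + n * \<delta> i) + n * \<delta> i * (\<Sum>s<n. y s i)"
        by simp
      then show ?thesis by (simp add: algebra_simps)
    qed
    have t: "t i = (m + n) * \<delta> i * (v i + \<tau> / (m + n))" if "i < m" for i
    proof -
      have "t i = \<theta> i * (1 + n * \<delta> i) * (v i + \<tau> / (m + n))"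
        using S[OF that] by (simp add: t_def)
      then show ?thesis by (simp only: \<theta>)
    qed
    have "t i = (m + n) * (\<delta> i * v i) + \<delta> i * \<tau>" if "i < m" for i
    proof -
      have "(m + n) * (v i + \<tau> / (m + n)) = (m + n) * v i + \<tau>"
        using mn by (simp add: distrib_left)
      moreover have "t i = \<delta> i * ((m + n) * (v i + \<tau> / (m + n)))"
        by (simp only: t[OF that] mult_ac)
      ultimately show ?thesis by (simp only:) (simp add: algebra_simps)
    qed
    \<comment> \<open>Now t involves the unknowns only through \<open>\<tau>\<close>. Summing over i
      gives one scalar equation in which W remains as the coefficient of \<open>\<tau>\<close>, so W
      \<noteq> 0 determines it.\<close>
    then have "\<tau> = (\<Sum>i<m. (m + n) * (\<delta> i * v i) + \<delta> i * \<tau>)"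
      unfolding \<tau>_def by (intro sum.cong refl) auto
    also have "\<dots> = (m + n) * q + (1 - W) * \<tau>"
      by (simp add: sum.distrib q_def sum_distrib_left sum_distrib_right flip: sum_\<delta>)
    finally have \<tau>: "\<tau> = (m + n) * (q / W)" using W by (simp add: field_simps)
    have tu: "t i = - ((m + n) * u i)" if "i < m" for i
      using t[OF that] mn by (simp add: \<tau> u_def)
    have "t i + \<tau> / n = - ((m + n) * (u i + (\<Sum>k<m. u k) / n))" if "i < m" for i
      unfolding tu[OF that] sum_u \<tau> by (simp add: distrib_left right_diff_distrib)
    then show "\<forall>j<n. \<forall>i<m. y j i = yh j i - (u i + (\<Sum>k<m. u k) / n)"
      using y mn by (simp only:) simp
  next
    assume y: "\<forall>j<n. \<forall>i<m. y j i = yh j i - (u i + (\<Sum>k<m. u k) / n)"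
    show "\<forall>j<n. \<forall>i<m. (m + n) * y j i - (\<Sum>k<m. y j k) - \<theta> i * (\<Sum>s<n. y s i) = b j i"
    proof (intro allI impI)
      fix j i assume "j < n" "i < m"
      \<comment> \<open>The choice of u makes the sum of the blocks equal to (1 + n \<delta>)(v + q
        / W). Multiplied by \<theta> this is - (m + n) u, so subtracting it cancels the u term of (m
        + n) y.\<close>
      have "(\<Sum>s<n. y s i) = (\<Sum>s<n. yh s i - (u i - q / W / n))"
        using y \<open>i < m\<close> by (intro sum.cong refl) (auto simp: sum_u)
      also have "\<dots> = v i - n * u i + q / W"
        using mn by (simp add: v_def sum_subtractf sum.distrib field_simps)
      also have "\<dots> = (1 + n * \<delta> i) * (v i + q / W)"
        by (simp add: u_def algebra_simps)
      finally have "\<theta> i * (\<Sum>s<n. y s i) = \<theta> i * (1 + n * \<delta> i) * (v i + q / W)" by simp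
      then have tu: "\<theta> i * (\<Sum>s<n. y s i) = - ((m + n) * u i)"
        unfolding \<theta> by (simp add: u_def)
      have average: "x + m * x / n = (m + n) * x / n" for x :: real
        using mn by (simp add: field_simps)
      have "(\<Sum>k<m. y j k) = (\<Sum>k<m. (b j k + (\<Sum>k<m. b j k) / n) / (m + n) - (u k + (\<Sum>k<m. u k) / n))"
        using y \<open>j < n\<close> by (intro sum.cong refl) (auto simp: yh)
      also have "\<dots> = ((\<Sum>k<m. b j k) + m * (\<Sum>k<m. b j k) / n) / (m + n) - ((\<Sum>k<m. u k) + m * (\<Sum>k<m. u k) / n)"
        by (simp add: sum_subtractf sum.distrib flip: sum_divide_distrib)
      also have "\<dots> = (\<Sum>k<m. b j k) / n - (m + n) * (\<Sum>k<m. u k) / n"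
        unfolding average by (simp add: average add_divide_distrib)
      finally have sum_y: "(\<Sum>k<m. y j k) = (\<Sum>k<m. b j k) / n - (m + n) * (\<Sum>k<m. u k) / n" .
      have "(m + n) * y j i = (b j i + (\<Sum>k<m. b j k) / n) - (m + n) * (u i + (\<Sum>k<m. u k) / n)"
        using y \<open>j < n\<close> \<open>i < m\<close> mn by (simp add: yh right_diff_distrib)
      then show "(m + n) * y j i - (\<Sum>k<m. y j k) - \<theta> i * (\<Sum>s<n. y s i) = b j i"
        unfolding tu sum_y by (simp add: distrib_left)
    qed
  }
qed

section \<open>The entries of the closed form\<close>

lemma block_index [simp]:
  assumes "i < m" "m * j + i < dim_vec v"
  shows "block m v j $ i = v $ (m * j + i)"
  using assms by (simp add: block_def)

lemma block_carrier:
  assumes "v \<in> carrier_vec p" "m * j + m \<le> p"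
  shows "block m v j \<in> carrier_vec m"
  using assms by (intro carrier_vecI) (simp add: block_def)

lemma ones_vec_index [simp]: "i < p \<Longrightarrow> ones_vec p $ i = 1"
  and dim_ones_vec [simp]: "dim_vec (ones_vec p) = p"
  by (simp_all add: ones_vec_def)

lemma ones_vec_scalar_prod: "ones_vec p \<bullet> v = (\<Sum>k<dim_vec v. v $ k)" if "dim_vec v \<le> p"
  using that by (simp add: scalar_prod_def lessThan_atLeast0)

lemma Ibar_mult_vec_index:
  assumes "x \<in> carrier_vec m" "i < m - 1"
  shows "(Ibar m *\<^sub>v x) $ i = x $ i"
  using assms
  by (subst selector_mat_mult_vec_index[where nr = "m - 1" and nc = m and \<phi> = "\<lambda>c. c" and s = 1])
    (auto simp: Ibar_def)

lemma transpose_Ibar_mult_vec_index: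
  assumes "x \<in> carrier_vec (m - 1)" "i < m"
  shows "(transpose_mat (Ibar m) *\<^sub>v x) $ i = (if i < m - 1 then x $ i else 0)"
  using assms
  by (subst selector_mat_transpose_mult_vec_index[where nr = "m - 1" and nc = m and t = i and s = 1])
    (auto simp: Ibar_def)

lemma finsum_vec_block_index:
  assumes "v \<in> carrier_vec p" "m * k \<le> p" "i < m"
  shows "finsum_vec TYPE(real) m (block m v) {..<k} $ i = (\<Sum>s<k. v $ (m * s + i))"
proof -
  have s: "m * s + m \<le> p" if "s < k" for s
  proof -
    have "m * s + m = m * (s + 1)" by simp
    also have "\<dots> \<le> m * k" using that by (intro mult_left_mono) auto
    finally show ?thesis using assms by simp
  qed
  then have "finsum_vec TYPE(real) m (block m v) {..<k} $ i = (\<Sum>s<k. block m v s $ i)"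
    using assms by (intro index_finsum_vec) (auto intro!: block_carrier)
  also have "\<dots> = (\<Sum>s<k. v $ (m * s + i))"
    using s assms by (intro sum.cong refl) (force intro!: block_index)
  finally show ?thesis .
qed

text \<open>The entries of d as a total function, since the coupled equation asks for \<delta> at
  every index. The two values are \<theta> / (m + n - n \<theta>) for \<theta> = 1 and \<theta> = 1
  - 1 / n.\<close>

definition d_entry :: "nat \<Rightarrow> nat \<Rightarrow> nat \<Rightarrow> real" where
  "d_entry m n i = (if i < m - 1 then 1 / m else d_last m n)"

context
  fixes m n :: nat
  assumes pos: "m > 0" "n > 0"
begin

lemma less_full_block: "j < n \<Longrightarrow> m * j + m \<le> m * n"
  using mult_le_mono2[of "Suc j" n m] by simp

lemma last_block_offset: "m * n - 1 = m * (n - 1) + (m - 1)"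
  using pos by (cases n; cases m) auto

lemma last_block_less_iff: "m * (n - 1) + i < m * n - 1 \<longleftrightarrow> i < m - 1"
  unfolding last_block_offset by simp

lemma less_pred_block:
  assumes "j < n - 1"
  shows "m * j + m \<le> m * n - 1"
proof -
  have "m * Suc j + m \<le> m * n" using assms by (intro less_full_block) simp
  then have "m + (m * j + m) \<le> m * n" by simp
  then show ?thesis using pos by linarith
qed

lemma block_last_carrier:
  assumes "v \<in> carrier_vec (m * n - 1)"
  shows "block m v (n - 1) \<in> carrier_vec (m - 1)"
proof -
  have "m * n - 1 - m * (n - 1) = m - 1" unfolding last_block_offset by simp
  then show ?thesis using assms by (intro carrier_vecI) (simp add: block_def)
qed

text \<open>The guard excludes only the last entry of the last block. This separates the n - 1 full
  blocks from the short one, as the closed form for \<open>y3\<close> does.\<close>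

lemma block_all_cases:
  "(\<forall>j<n. \<forall>i<m. m * j + i < m * n - 1 \<longrightarrow> P j i) \<longleftrightarrow>
   (\<forall>j<n - 1. \<forall>i<m. P j i) \<and> (\<forall>i<m - 1. P (n - 1) i)"
proof (intro iffI conjI allI impI)
  fix j i assume *: "\<forall>j<n. \<forall>i<m. m * j + i < m * n - 1 \<longrightarrow> P j i" "j < n - 1" "i < m"
  then show "P j i" using less_pred_block[of j] by auto
next
  fix i assume *: "\<forall>j<n. \<forall>i<m. m * j + i < m * n - 1 \<longrightarrow> P j i" "i < m - 1"
  then show "P (n - 1) i" using last_block_less_iff pos by auto
next
  fix j i assume *: "(\<forall>j<n - 1. \<forall>i<m. P j i) \<and> (\<forall>i<m - 1. P (n - 1) i)"
    "j < n" "i < m" "m * j + i < m * n - 1"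
  show "P j i"
  proof (cases "j = n - 1")
    case True
    then have "i < m - 1" using last_block_less_iff *(4) by blast
    then show ?thesis using * True by simp
  qed (use * in auto)
qed

text \<open>Coordinate m - 1 gets nothing from the last block. This missing term accounts both for
  the transpose of \<open>Ibar\<close> in \<open>Rtilde3\<close> and for the entry 1 - 1 / n of the
  coupling.\<close>

lemma sum_zero_pad:
  assumes "v \<in> carrier_vec (m * n - 1)" "i < m"
  shows "(\<Sum>s<n. zero_pad v (m * s + i))
    = (\<Sum>s<n - 1. v $ (m * s + i)) + (if i < m - 1 then v $ (m * (n - 1) + i) else 0)"
proof -
  have "{..<n} = insert (n - 1) {..<n - 1}" using pos by auto
  then have "(\<Sum>s<n. zero_pad v (m * s + i))
      = (\<Sum>s<n - 1. zero_pad v (m * s + i)) + zero_pad v (m * (n - 1) + i)"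
    by simp
  moreover have "(\<Sum>s<n - 1. zero_pad v (m * s + i)) = (\<Sum>s<n - 1. v $ (m * s + i))"
    using less_pred_block assms by (intro sum.cong refl) (force simp: zero_pad_def)
  moreover have "m * (n - 1) + i < m * n - 1 \<longleftrightarrow> i < m - 1"
    by (rule last_block_less_iff)
  ultimately show ?thesis using assms(1) by (simp add: zero_pad_def)
qed

text \<open>b is the right-hand side left for \<open>y1\<close> once \<open>y2\<close> and
  \<open>y3\<close> are eliminated, and the tilde terms arise from its three summands by adding to
  each entry the block total divided by n. On the constant vector coming from \<open>R2\<close> this
  is the factor 1 + m / n, hence 1 / m + 1 / n; the part from \<open>R3\<close> already carries 1 /
  n, hence 1 / n squared on its total.\<close>

lemma yhat1_index:
  assumes R: "R1 \<in> carrier_vec (m * n)" "R2 \<in> carrier_vec (m * n)" "R3 \<in> carrier_vec (m * n - 1)"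
    and j: "j < n" and i: "i < m"
  defines "b \<equiv> \<lambda>j i. R1 $ (m * j + i) - (\<Sum>k<m. R2 $ (m * j + k)) / m
    + (\<Sum>s<n. zero_pad R3 (m * s + i)) / n"
  shows "yhat1 m n R1 R2 R3 j $ i = (b j i + (\<Sum>k<m. b j k) / n) / (m + n)"
    and "yhat1 m n R1 R2 R3 j \<in> carrier_vec m"
proof -
  let ?r = "\<lambda>i. \<Sum>s<n. zero_pad R3 (m * s + i)"
  let ?S1 = "\<Sum>k<m. R1 $ (m * j + k)" and ?S2 = "\<Sum>k<m. R2 $ (m * j + k)"
  have ones: "ones_vec m \<bullet> block m v j = (\<Sum>k<m. v $ (m * j + k))" if "v \<in> carrier_vec (m * n)" for v
    using that less_mult_index[OF j] carrier_vecD[OF block_carrier[OF that less_full_block[OF j]]]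
    by (simp add: ones_vec_scalar_prod)
  have b1: "block m R1 j \<in> carrier_vec m" and b3: "block m R3 (n - 1) \<in> carrier_vec (m - 1)"
    using block_carrier[OF R(1) less_full_block[OF j]] block_last_carrier[OF R(3)] by auto
  have sumR3: "ones_vec (m * n - 1) \<bullet> R3 = (\<Sum>k<m. ?r k)"
  proof -
    have "ones_vec (m * n - 1) \<bullet> R3 = (\<Sum>r<m * n - 1. zero_pad R3 r)"
      using R(3) by (simp add: ones_vec_scalar_prod zero_pad_def)
    \<comment> \<open>The padding adds a zero at index m n - 1, so the sum runs over full blocks and
      can be regrouped by coordinate.\<close>
    also have "\<dots> = (\<Sum>r<m * n. zero_pad R3 r)"
      using R(3) by (intro sum.mono_neutral_left) (auto simp: zero_pad_def)
    also have "\<dots> = (\<Sum>k<m. ?r k)"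
      unfolding sum_lessThan_mult by (rule sum.swap)
    finally show ?thesis .
  qed
  have fin: "finsum_vec TYPE(real) m (block m R3) {..<n - 1} \<in> carrier_vec m"
    using less_pred_block R(3) by (intro finsum_vec_closed) (auto intro!: block_carrier)
  have le: "m * (n - 1) \<le> m * n - 1" unfolding last_block_offset by simp
  have b3i: "block m R3 (n - 1) $ i = R3 $ (m * (n - 1) + i)" if "i < m - 1"
    using that i R(3) last_block_less_iff by (intro block_index) auto
  have Ib: "dim_row (transpose_mat (Ibar m)) = m" by (simp add: Ibar_def)
  have r3: "Rtilde3 m n R3 $ i = ?r i / n + (\<Sum>k<m. ?r k) / n\<^sup>2"
    using finsum_vec_block_index[OF R(3) le i] transpose_Ibar_mult_vec_index[OF b3 i] fin Ib i
    by (simp add: Rtilde3_def sumR3 sum_zero_pad[OF R(3) i] b3i del: index_transpose_mat index_mult_mat_vec One_nat_def)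
  have r1: "Rtilde1 m n R1 j $ i = R1 $ (m * j + i) + ?S1 / n"
    using i less_mult_index[OF j i] R b1 by (simp add: Rtilde1_def ones)
  have r2: "Rtilde2 m n R2 j $ i = - (1 / m + 1 / n) * ?S2"
    using i R by (simp add: Rtilde2_def ones)
  have c: "Rtilde1 m n R1 j \<in> carrier_vec m" "Rtilde2 m n R2 j \<in> carrier_vec m" "Rtilde3 m n R3 \<in> carrier_vec m"
    by (auto simp: Rtilde1_def Rtilde2_def Rtilde3_def intro!: carrier_vecI)
  then show "yhat1 m n R1 R2 R3 j \<in> carrier_vec m"
    by (auto simp: yhat1_def)
  have "(\<Sum>k<m. b j k) = ?S1 - ?S2 + (\<Sum>k<m. ?r k) / n"
    using pos by (simp add: b_def sum.distrib sum_subtractf flip: sum_divide_distrib)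
  moreover have "b j i + (?S1 - ?S2 + (\<Sum>k<m. ?r k) / n) / n
      = Rtilde1 m n R1 j $ i + Rtilde2 m n R2 j $ i + Rtilde3 m n R3 $ i"
    unfolding r1 r2 r3 by (simp add: b_def add_divide_distrib diff_divide_distrib algebra_simps power2_eq_square)
  ultimately show "yhat1 m n R1 R2 R3 j $ i = (b j i + (\<Sum>k<m. b j k) / n) / (m + n)"
    using c i by (simp add: yhat1_def)
qed

lemma d_vec_carrier: "d_vec m n \<in> carrier_vec m"
  using pos by (intro carrier_vecI) (simp add: d_vec_def)

lemma d_vec_index: "i < m \<Longrightarrow> d_vec m n $ i = d_entry m n i"
  by (auto simp: d_vec_def d_entry_def)

text \<open>Diagonal plus rank one, brought into the shape - \<delta> (v + q / W) in which the
  coupled equation delivers its correction u.\<close>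

lemma What_mult_vec_index:
  assumes "v \<in> carrier_vec m" "i < m"
  shows "(What m n *\<^sub>v v) $ i = - d_entry m n i * (v $ i + (\<Sum>k<m. d_entry m n k * v $ k) / w m n)"
    and "What m n *\<^sub>v v \<in> carrier_vec m"
proof -
  have W: "What m n \<in> carrier_mat m m"
    using pos d_vec_carrier by (auto simp: What_def outer_prod_def)
  then show "What m n *\<^sub>v v \<in> carrier_vec m"
    using assms(1) by (rule mult_mat_vec_carrier)
  have W_index: "What m n $$ (i, k) = - (if k = i then d_entry m n i else 0) - d_entry m n i * d_entry m n k / w m n" if "k < m" for k
    using that assms(2) pos d_vec_carrier d_vec_index
    by (auto simp: What_def outer_prod_def d_entry_def)
  have "(What m n *\<^sub>v v) $ i = (\<Sum>k<m. What m n $$ (i, k) * v $ k)"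
    using W assms by (auto simp: scalar_prod_def lessThan_atLeast0)
  also have "\<dots> = (\<Sum>k<m. - (if k = i then d_entry m n i * v $ k else 0) - d_entry m n i * (d_entry m n k * v $ k / w m n))"
    by (intro sum.cong refl) (simp add: W_index left_diff_distrib)
  also have "\<dots> = - d_entry m n i * v $ i - d_entry m n i * (\<Sum>k<m. d_entry m n k * v $ k / w m n)"
    using assms by (simp add: sum_subtractf sum_negf sum_distrib_left)
  finally show "(What m n *\<^sub>v v) $ i = - d_entry m n i * (v $ i + (\<Sum>k<m. d_entry m n k * v $ k) / w m n)"
    by (simp add: algebra_simps sum_divide_distrib)
qed

lemma rank_one_update_mult_vec_index:
  assumes "u \<in> carrier_vec m" "i < m"
  shows "((1\<^sub>m m + (1 / real n) \<cdot>\<^sub>m outer_prod (ones_vec m) (ones_vec m)) *\<^sub>v u) $ i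
    = u $ i + (\<Sum>k<m. u $ k) / n"
proof -
  have "((1\<^sub>m m + (1 / real n) \<cdot>\<^sub>m outer_prod (ones_vec m) (ones_vec m)) *\<^sub>v u) $ i
      = (\<Sum>k<m. (if k = i then u $ k else 0) + u $ k / n)"
    using assms by (auto simp: outer_prod_def scalar_prod_def lessThan_atLeast0 algebra_simps intro!: sum.cong)
  then show ?thesis using assms by (simp add: sum.distrib sum_divide_distrib)
qed

text \<open>The last entry of d is at most 1 / (m + 1), strictly below 1 / m. This supplies the
  nonzero pivot W of the coupled equation.\<close>

lemma w_pos: "w m n > 0"
proof -
  have "1 / (real m + 1) * (1 - 1 / real n) \<le> 1 / (real m + 1)"
    by (simp add: divide_simps)
  also have "\<dots> < 1 / real m" using pos by (simp add: divide_simps)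
  finally show ?thesis by (simp add: w_def)
qed

lemma sum_d_entry: "(\<Sum>i<m. d_entry m n i) = 1 - w m n"
proof -
  have "{..<m} = insert (m - 1) {..<m - 1}" using pos by auto
  then have "(\<Sum>i<m. d_entry m n i) = (\<Sum>i<m - 1. 1 / m) + d_last m n"
    by (simp add: d_entry_def)
  then show ?thesis using pos by (simp add: w_def d_last_def of_nat_diff field_simps)
qed

lemma d_entry_nonneg: "d_entry m n i \<ge> 0"
  using pos by (auto simp: d_entry_def d_last_def)

lemma d_entry_coupling:
  "(if i < m - 1 then 1 else 1 - 1 / n) * (1 + n * d_entry m n i) = (m + n) * d_entry m n i"
proof (cases "i < m - 1")
  case False
  have "n * (1 - 1 / n) = real n - 1" using pos by (simp add: field_simps)
  then have "1 + n * d_last m n = (m + n) / (m + 1)"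
    by (simp add: d_last_def) (simp add: field_simps)
  then show ?thesis using False by (simp add: d_entry_def d_last_def ac_simps)
qed (use pos in \<open>simp add: d_entry_def field_simps\<close>)

lemma solution_index:
  assumes R: "R1 \<in> carrier_vec (m * n)" "R2 \<in> carrier_vec (m * n)" "R3 \<in> carrier_vec (m * n - 1)"
    and i: "i < m"
  defines "v \<equiv> \<lambda>i. \<Sum>j<n. yhat1 m n R1 R2 R3 j $ i"
  defines "u \<equiv> \<lambda>i. - d_entry m n i * (v i + (\<Sum>k<m. d_entry m n k * v k) / w m n)"
  shows "yhat1_a m n R1 R2 R3 $ i = u i + (\<Sum>k<m. u k) / n"
proof -
  let ?v = "finsum_vec TYPE(real) m (yhat1 m n R1 R2 R3) {..<n}"
  have c: "yhat1 m n R1 R2 R3 \<in> {..<n} \<rightarrow> carrier_vec m"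
    using yhat1_index(2)[OF R _ i] by auto
  then have vc: "?v \<in> carrier_vec m" by (rule finsum_vec_closed)
  have v: "?v $ k = v k" if "k < m" for k
    using index_finsum_vec[OF _ that c] by (simp add: v_def)
  have "(What m n *\<^sub>v ?v) $ k = u k" if "k < m" for k
    using What_mult_vec_index(1)[OF vc that] v that by (simp add: u_def)
  then show ?thesis
    unfolding yhat1_a_def rank_one_update_mult_vec_index[OF What_mult_vec_index(2)[OF vc i] i]
    using i by simp
qed

end

section \<open>The solution\<close>

context
  fixes m n :: nat
  assumes pos: "m > 0" "n > 0"
begin

lemma vec_eq_block_iff:
  assumes "v \<in> carrier_vec (m * n)" "j < n" "x \<in> carrier_vec m"
  shows "block m v j = x \<longleftrightarrow> (\<forall>i<m. v $ (m * j + i) = x $ i)"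
  using assms block_carrier[OF assms(1) less_full_block[OF pos assms(2)]] less_mult_index[OF assms(2)]
  by (auto simp: vec_eq_iff)

lemma solution_blocks_iff:
  assumes y: "y1 \<in> carrier_vec (m * n)" "y2 \<in> carrier_vec (m * n)" "y3 \<in> carrier_vec (m * n - 1)"
    and R: "R1 \<in> carrier_vec (m * n)" "R2 \<in> carrier_vec (m * n)" "R3 \<in> carrier_vec (m * n - 1)"
  shows
    "(\<forall>j<n. block m y2 j =
        (1 / real m) \<cdot>\<^sub>v (block m R2 j - (ones_vec m \<bullet> block m y1 j) \<cdot>\<^sub>v ones_vec m)) \<longleftrightarrow>
     (\<forall>j<n. \<forall>i<m. y2 $ (m * j + i) = (R2 $ (m * j + i) - (\<Sum>k<m. y1 $ (m * j + k))) / m)"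
    and "(\<forall>j<n - 1. block m y3 j =
        (1 / real n) \<cdot>\<^sub>v (block m R3 j + finsum_vec TYPE(real) m (block m y1) {..<n})) \<and>
      block m y3 (n - 1) =
        (1 / real n) \<cdot>\<^sub>v (block m R3 (n - 1) + Ibar m *\<^sub>v finsum_vec TYPE(real) m (block m y1) {..<n}) \<longleftrightarrow>
     (\<forall>j<n. \<forall>i<m. m * j + i < m * n - 1 \<longrightarrow>
        y3 $ (m * j + i) = (R3 $ (m * j + i) + (\<Sum>s<n. y1 $ (m * s + i))) / n)"
    and "(\<forall>j<n. block m y1 j = yhat1 m n R1 R2 R3 j - yhat1_a m n R1 R2 R3) \<longleftrightarrow>
     (\<forall>j<n. \<forall>i<m. y1 $ (m * j + i) = yhat1 m n R1 R2 R3 j $ i - yhat1_a m n R1 R2 R3 $ i)"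
proof -
  let ?F = "finsum_vec TYPE(real) m (block m y1) {..<n}"
  have F: "?F \<in> carrier_vec m"
    using less_full_block[OF pos] y(1) by (intro finsum_vec_closed) (auto intro!: block_carrier)
  have F_index: "?F $ i = (\<Sum>s<n. y1 $ (m * s + i))" if "i < m" for i
    using finsum_vec_block_index[OF y(1) order_refl that] .
  have full: "block m v j \<in> carrier_vec m" if "v \<in> carrier_vec (m * n)" "j < n" for v j
    using block_carrier[OF that(1) less_full_block[OF pos that(2)]] .
  have full3: "block m v j \<in> carrier_vec m" if "v \<in> carrier_vec (m * n - 1)" "j < n - 1" for v j
    using block_carrier[OF that(1) less_pred_block[OF pos that(2)]] .
  have ones: "ones_vec m \<bullet> block m y1 j = (\<Sum>k<m. y1 $ (m * j + k))" if "j < n" for j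
    using that y(1) less_mult_index[OF that] carrier_vecD[OF full[OF y(1) that]]
    by (simp add: ones_vec_scalar_prod)
  show "(\<forall>j<n. block m y2 j =
        (1 / real m) \<cdot>\<^sub>v (block m R2 j - (ones_vec m \<bullet> block m y1 j) \<cdot>\<^sub>v ones_vec m)) \<longleftrightarrow>
     (\<forall>j<n. \<forall>i<m. y2 $ (m * j + i) = (R2 $ (m * j + i) - (\<Sum>k<m. y1 $ (m * j + k))) / m)"
  proof (intro all_cong)
    fix j assume j: "j < n"
    have "(1 / real m) \<cdot>\<^sub>v (block m R2 j - (ones_vec m \<bullet> block m y1 j) \<cdot>\<^sub>v ones_vec m) \<in> carrier_vec m"
      by (intro carrier_vecI) simp
    from vec_eq_block_iff[OF y(2) j this]
    show "(block m y2 j = (1 / real m) \<cdot>\<^sub>v (block m R2 j - (ones_vec m \<bullet> block m y1 j) \<cdot>\<^sub>v ones_vec m)) \<longleftrightarrow>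
      (\<forall>i<m. y2 $ (m * j + i) = (R2 $ (m * j + i) - (\<Sum>k<m. y1 $ (m * j + k))) / m)"
      using full[OF R(2) j] less_mult_index[OF j] R(2) by (simp add: ones[OF j])
  qed
  show "(\<forall>j<n - 1. block m y3 j = (1 / real n) \<cdot>\<^sub>v (block m R3 j + ?F)) \<and>
      block m y3 (n - 1) = (1 / real n) \<cdot>\<^sub>v (block m R3 (n - 1) + Ibar m *\<^sub>v ?F) \<longleftrightarrow>
     (\<forall>j<n. \<forall>i<m. m * j + i < m * n - 1 \<longrightarrow>
        y3 $ (m * j + i) = (R3 $ (m * j + i) + (\<Sum>s<n. y1 $ (m * s + i))) / n)"
    unfolding block_all_cases[OF pos]
  proof (intro arg_cong2[where f = "(\<and>)"] all_cong)
    fix j assume j: "j < n - 1"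
    have "m * j + i < m * n - 1" if "i < m" for i
      using less_pred_block[OF pos j] that by linarith
    then show "(block m y3 j = (1 / real n) \<cdot>\<^sub>v (block m R3 j + ?F)) \<longleftrightarrow>
      (\<forall>i<m. y3 $ (m * j + i) = (R3 $ (m * j + i) + (\<Sum>s<n. y1 $ (m * s + i))) / n)"
      using full3[OF y(3) j] full3[OF R(3) j] F y(3) R(3) by (auto simp: vec_eq_iff F_index)
  next
    have c: "block m y3 (n - 1) \<in> carrier_vec (m - 1)" "block m R3 (n - 1) \<in> carrier_vec (m - 1)"
      using block_last_carrier[OF pos] y(3) R(3) by auto
    have "block m v (n - 1) $ i = v $ (m * (n - 1) + i)" if "i < m - 1" "v \<in> carrier_vec (m * n - 1)" for i v
      using that last_block_less_iff[OF pos] by (intro block_index) auto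
    moreover have "dim_row (Ibar m) = m - 1" by (simp add: Ibar_def)
    ultimately show "(block m y3 (n - 1) = (1 / real n) \<cdot>\<^sub>v (block m R3 (n - 1) + Ibar m *\<^sub>v ?F)) \<longleftrightarrow>
      (\<forall>i<m - 1. y3 $ (m * (n - 1) + i) = (R3 $ (m * (n - 1) + i) + (\<Sum>s<n. y1 $ (m * s + i))) / n)"
      using c y(3) R(3) Ibar_mult_vec_index[OF F]
      by (auto simp: vec_eq_iff F_index simp del: One_nat_def index_mult_mat_vec)
  qed
  show "(\<forall>j<n. block m y1 j = yhat1 m n R1 R2 R3 j - yhat1_a m n R1 R2 R3) \<longleftrightarrow>
     (\<forall>j<n. \<forall>i<m. y1 $ (m * j + i) = yhat1 m n R1 R2 R3 j $ i - yhat1_a m n R1 R2 R3 $ i)"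
  proof (intro all_cong)
    fix j assume j: "j < n"
    have a: "yhat1_a m n R1 R2 R3 \<in> carrier_vec m"
      unfolding yhat1_a_def outer_prod_def by (intro carrier_vecI) simp
    from vec_eq_block_iff[OF y(1) j minus_carrier_vec[OF yhat1_index(2)[OF pos R j pos(1)] this]]
    show "(block m y1 j = yhat1 m n R1 R2 R3 j - yhat1_a m n R1 R2 R3) \<longleftrightarrow>
      (\<forall>i<m. y1 $ (m * j + i) = yhat1 m n R1 R2 R3 j $ i - yhat1_a m n R1 R2 R3 $ i)"
      using a by simp
  qed
qed

text \<open>The second and third groups are equivalent to \<open>?Y2\<close> and \<open>?Y3\<close>
  by rearrangement alone. The first becomes an equation in \<open>y1\<close> only after substituting
  these, so its equivalence with \<open>?Y1\<close> is proved under both and combined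
  propositionally.\<close>

lemma normal_equations_iff_closed_form:
  assumes y: "y1 \<in> carrier_vec (m * n)" "y2 \<in> carrier_vec (m * n)" "y3 \<in> carrier_vec (m * n - 1)"
    and R: "R1 \<in> carrier_vec (m * n)" "R2 \<in> carrier_vec (m * n)" "R3 \<in> carrier_vec (m * n - 1)"
  shows "(constraint_mat m n * transpose_mat (constraint_mat m n)) *\<^sub>v (y1 @\<^sub>v y2 @\<^sub>v y3)
      = R1 @\<^sub>v R2 @\<^sub>v R3 \<longleftrightarrow>
    (\<forall>j<n. \<forall>i<m. y2 $ (m * j + i) = (R2 $ (m * j + i) - (\<Sum>k<m. y1 $ (m * j + k))) / m) \<and>
    (\<forall>j<n. \<forall>i<m. m * j + i < m * n - 1 \<longrightarrow>
        y3 $ (m * j + i) = (R3 $ (m * j + i) + (\<Sum>s<n. y1 $ (m * s + i))) / n) \<and>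
    (\<forall>j<n. \<forall>i<m. y1 $ (m * j + i) = yhat1 m n R1 R2 R3 j $ i - yhat1_a m n R1 R2 R3 $ i)"
    (is "_ \<longleftrightarrow> ?Y2 \<and> ?Y3 \<and> ?Y1")
proof -
  let ?E1 = "\<forall>j<n. \<forall>i<m. (m + n) * y1 $ (m * j + i) + (\<Sum>k<m. y2 $ (m * j + k))
        - (\<Sum>s<n. zero_pad y3 (m * s + i)) = R1 $ (m * j + i)"
  let ?r = "\<lambda>i. \<Sum>s<n. zero_pad R3 (m * s + i)"
  define \<theta> where "\<theta> i = (if i < m - 1 then 1 else 1 - 1 / real n)" for i
  define b where "b j i = R1 $ (m * j + i) - (\<Sum>k<m. R2 $ (m * j + k)) / m + ?r i / n" for j i
  define yh where "yh j i = (b j i + (\<Sum>k<m. b j k) / n) / (m + n)" for j i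
  define v where "v i = (\<Sum>j<n. yh j i)" for i
  define u where "u i = - d_entry m n i * (v i + (\<Sum>k<m. d_entry m n k * v k) / w m n)" for i
  have mn: "real m > 0" "real n > 0" using pos by auto
  have Y2: "(\<forall>j<n. \<forall>i<m. (\<Sum>k<m. y1 $ (m * j + k)) + m * y2 $ (m * j + i) = R2 $ (m * j + i)) \<longleftrightarrow> ?Y2"
    using mn by (simp add: eq_divide_eq eq_diff_eq algebra_simps)
  have Y3: "(\<forall>j<n. \<forall>i<m. m * j + i < m * n - 1 \<longrightarrow>
        n * y3 $ (m * j + i) - (\<Sum>s<n. y1 $ (m * s + i)) = R3 $ (m * j + i)) \<longleftrightarrow> ?Y3"
    using mn by (simp add: eq_divide_eq diff_eq_eq algebra_simps)
  have E1: "?E1 \<longleftrightarrow> (\<forall>j<n. \<forall>i<m. (m + n) * y1 $ (m * j + i) - (\<Sum>k<m. y1 $ (m * j + k))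
      - \<theta> i * (\<Sum>s<n. y1 $ (m * s + i)) = b j i)" if Y2: ?Y2 and Y3: ?Y3
  proof (intro all_cong)
    fix j i assume "j < n" "i < m"
    have "(\<Sum>k<m. y2 $ (m * j + k)) = (\<Sum>k<m. (R2 $ (m * j + k) - (\<Sum>k<m. y1 $ (m * j + k))) / m)"
      using Y2 \<open>j < n\<close> by (intro sum.cong refl) auto
    also have "\<dots> = (\<Sum>k<m. R2 $ (m * j + k)) / m - (\<Sum>k<m. y1 $ (m * j + k))"
      using mn by (simp add: sum_subtractf diff_divide_distrib flip: sum_divide_distrib)
    finally have 2: "(\<Sum>k<m. y2 $ (m * j + k))
      = (\<Sum>k<m. R2 $ (m * j + k)) / m - (\<Sum>k<m. y1 $ (m * j + k))" .
    let ?S = "\<Sum>s<n. y1 $ (m * s + i)"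
    have "(\<Sum>s<n. zero_pad y3 (m * s + i))
      = (\<Sum>s<n - 1. y3 $ (m * s + i)) + (if i < m - 1 then y3 $ (m * (n - 1) + i) else 0)"
      by (rule sum_zero_pad[OF pos y(3) \<open>i < m\<close>])
    also have "\<dots> = (\<Sum>s<n - 1. (R3 $ (m * s + i) + ?S) / n)
        + (if i < m - 1 then (R3 $ (m * (n - 1) + i) + ?S) / n else 0)"
      using Y3[unfolded block_all_cases[OF pos]] \<open>i < m\<close>
      by (intro arg_cong2[where f = "(+)"] sum.cong refl) auto
    also have "\<dots> = ?r i / n + ((n - 1) * ?S / n + (if i < m - 1 then ?S / n else 0))"
      unfolding sum_zero_pad[OF pos R(3) \<open>i < m\<close>]
      by (simp add: sum.distrib add_divide_distrib flip: sum_divide_distrib)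
    \<comment> \<open>Each of the n - 1 full blocks contributes S / n, the last block only below
      coordinate m - 1: the coefficient is 1, or 1 - 1 / n at the end.\<close>
    also have "(n - 1) * ?S / n + (if i < m - 1 then ?S / n else 0) = \<theta> i * ?S"
      using pos by (simp add: \<theta>_def of_nat_diff field_simps)
    finally show "(m + n) * y1 $ (m * j + i) + (\<Sum>k<m. y2 $ (m * j + k))
        - (\<Sum>s<n. zero_pad y3 (m * s + i)) = R1 $ (m * j + i) \<longleftrightarrow>
      (m + n) * y1 $ (m * j + i) - (\<Sum>k<m. y1 $ (m * j + k)) - \<theta> i * ?S = b j i"
      unfolding 2 b_def by (auto simp: algebra_simps)
  qed
  have "(\<forall>j<n. \<forall>i<m. (m + n) * y1 $ (m * j + i) - (\<Sum>k<m. y1 $ (m * j + k))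
      - \<theta> i * (\<Sum>s<n. y1 $ (m * s + i)) = b j i) \<longleftrightarrow>
    (\<forall>j<n. \<forall>i<m. y1 $ (m * j + i) = yh j i - (u i + (\<Sum>k<m. u k) / n))"
    unfolding u_def v_def
    using coupled_blocks_solution[where y = "\<lambda>j i. y1 $ (m * j + i)" and b = b and yh = yh
        and \<delta> = "d_entry m n" and \<theta> = \<theta> and W = "w m n",
        OF pos d_entry_nonneg[OF pos] d_entry_coupling[OF pos, folded \<theta>_def] sum_d_entry[OF pos] _ yh_def]
      w_pos[OF pos] by simp
  also have "\<dots> \<longleftrightarrow> ?Y1"
  proof (intro all_cong)
    fix j i assume j: "j < n" and i: "i < m"
    have yh: "yhat1 m n R1 R2 R3 j $ i = yh j i" if "j < n" "i < m" for j i
      using yhat1_index(1)[OF pos R that] by (simp add: yh_def b_def)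
    have "(\<Sum>j<n. yhat1 m n R1 R2 R3 j $ i) = v i" if "i < m" for i
      using yh that by (simp add: v_def)
    then have "yhat1_a m n R1 R2 R3 $ i = u i + (\<Sum>k<m. u k) / n"
      using solution_index[OF pos R i] i by (simp add: u_def)
    then show "y1 $ (m * j + i) = yh j i - (u i + (\<Sum>k<m. u k) / n) \<longleftrightarrow>
      y1 $ (m * j + i) = yhat1 m n R1 R2 R3 j $ i - yhat1_a m n R1 R2 R3 $ i"
      using yh i j by simp
  qed
  finally have E1_iff: "?E1 \<longleftrightarrow> ?Y1" if ?Y2 and ?Y3
    using E1[OF that] by (rule trans[rotated])
  have "E \<and> P \<and> Q \<longleftrightarrow> P \<and> Q \<and> Y" if "P \<Longrightarrow> Q \<Longrightarrow> E \<longleftrightarrow> Y" for E P Q Y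
    using that by blast
  from this[OF E1_iff] show ?thesis
    unfolding normal_equations[OF pos y R] Y2 Y3 .
qed

end

theorem proposition4:
  fixes m n :: nat and R1 R2 R3 :: "real vec"
  assumes "m > 0" and "n > 0"
    and "R1 \<in> carrier_vec (m * n)"
    and "R2 \<in> carrier_vec (m * n)"
    and "R3 \<in> carrier_vec (m * n - 1)"
  shows "(\<exists>!y. y \<in> carrier_vec (3 * (m * n) - 1) \<and>
            (constraint_mat m n * transpose_mat (constraint_mat m n)) *\<^sub>v y = R1 @\<^sub>v R2 @\<^sub>v R3) \<and>
    (\<forall>y1 \<in> carrier_vec (m * n). \<forall>y2 \<in> carrier_vec (m * n). \<forall>y3 \<in> carrier_vec (m * n - 1).
       (constraint_mat m n * transpose_mat (constraint_mat m n)) *\<^sub>v (y1 @\<^sub>v y2 @\<^sub>v y3)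
         = R1 @\<^sub>v R2 @\<^sub>v R3
       \<longleftrightarrow>
         (\<forall>j<n. block m y2 j =
            (1 / real m) \<cdot>\<^sub>v (block m R2 j - (ones_vec m \<bullet> block m y1 j) \<cdot>\<^sub>v ones_vec m)) \<and>
         (\<forall>j<n - 1. block m y3 j =
            (1 / real n) \<cdot>\<^sub>v (block m R3 j + finsum_vec TYPE(real) m (block m y1) {..<n})) \<and>
         block m y3 (n - 1) =
            (1 / real n) \<cdot>\<^sub>v (block m R3 (n - 1)
                             + Ibar m *\<^sub>v finsum_vec TYPE(real) m (block m y1) {..<n}) \<and>
         (\<forall>j<n. block m y1 j = yhat1 m n R1 R2 R3 j - yhat1_a m n R1 R2 R3))"
proof -
  let ?A = "constraint_mat m n" and ?M = "m * n"
  let ?G = "?A * transpose_mat ?A"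
  note pos = assms(1,2) and R = assms(3-5)
  note closed_form = normal_equations_iff_closed_form[OF pos _ _ _ R]
  have dim: "?M + (?M + (?M - 1)) = 3 * ?M - 1"
    using pos nat_0_less_mult_iff[of m n] by linarith
  have "\<exists>!y. y \<in> carrier_vec (3 * ?M - 1) \<and> ?G *\<^sub>v y = R1 @\<^sub>v R2 @\<^sub>v R3"
  proof
    \<comment> \<open>The witness follows the closed form by back substitution; quotient and
      remainder by m recover block and offset of a flat index.\<close>
    define y1 where "y1 = vec ?M (\<lambda>r. yhat1 m n R1 R2 R3 (r div m) $ (r mod m) - yhat1_a m n R1 R2 R3 $ (r mod m))"
    define y2 where "y2 = vec ?M (\<lambda>r. (R2 $ r - (\<Sum>k<m. y1 $ (m * (r div m) + k))) / m)"
    define y3 where "y3 = vec (?M - 1) (\<lambda>r. (R3 $ r + (\<Sum>s<n. y1 $ (m * s + r mod m))) / n)"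
    have c: "y1 \<in> carrier_vec ?M" "y2 \<in> carrier_vec ?M" "y3 \<in> carrier_vec (?M - 1)"
      by (auto simp: y1_def y2_def y3_def)
    have "?G *\<^sub>v (y1 @\<^sub>v y2 @\<^sub>v y3) = R1 @\<^sub>v R2 @\<^sub>v R3"
      unfolding closed_form[OF c]
      by (intro conjI) (auto simp: y2_def y3_def less_mult_index, auto simp: y1_def less_mult_index)
    then show "y1 @\<^sub>v y2 @\<^sub>v y3 \<in> carrier_vec (3 * ?M - 1) \<and> ?G *\<^sub>v (y1 @\<^sub>v y2 @\<^sub>v y3) = R1 @\<^sub>v R2 @\<^sub>v R3"
      using c by (metis append_carrier_vec dim)
    fix z assume z: "z \<in> carrier_vec (3 * ?M - 1) \<and> ?G *\<^sub>v z = R1 @\<^sub>v R2 @\<^sub>v R3"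
    define z1 where "z1 = vec_first z ?M"
    define z' where "z' = vec_last z (?M + (?M - 1))"
    define z2 where "z2 = vec_first z' ?M"
    define z3 where "z3 = vec_last z' (?M - 1)"
    have "z = z1 @\<^sub>v z'"
      unfolding z1_def z'_def by (rule vec_first_last_append[symmetric]) (use z dim in simp)
    also have "z' = z2 @\<^sub>v z3"
      unfolding z2_def z3_def by (rule vec_first_last_append[symmetric]) (simp add: z'_def)
    finally have z_eq: "z = z1 @\<^sub>v z2 @\<^sub>v z3" .
    have d: "z1 \<in> carrier_vec ?M" "z2 \<in> carrier_vec ?M" "z3 \<in> carrier_vec (?M - 1)"
      by (auto simp: z1_def z2_def z3_def)
    \<comment> \<open>Any solution satisfies the same explicit formulas, so its first part is
      forced, and through it the other two.\<close>
    note zs = z[unfolded z_eq closed_form[OF d]]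
      and ys = \<open>?G *\<^sub>v (y1 @\<^sub>v y2 @\<^sub>v y3) = R1 @\<^sub>v R2 @\<^sub>v R3\<close>[unfolded closed_form[OF c]]
    have e1: "z1 = y1"
      unfolding vec_eq_iff_blocks[OF d(1) c(1) order_refl] using zs ys by simp
    have "z2 = y2"
      unfolding vec_eq_iff_blocks[OF d(2) c(2) order_refl] using zs ys e1 by simp
    moreover have "z3 = y3"
      unfolding vec_eq_iff_blocks[OF d(3) c(3) diff_le_self] using zs ys e1 by simp
    ultimately show "z = y1 @\<^sub>v y2 @\<^sub>v y3" using e1 z_eq by simp
  qed
  moreover have "?G *\<^sub>v (y1 @\<^sub>v y2 @\<^sub>v y3) = R1 @\<^sub>v R2 @\<^sub>v R3 \<longleftrightarrow>
         (\<forall>j<n. block m y2 j =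
            (1 / real m) \<cdot>\<^sub>v (block m R2 j - (ones_vec m \<bullet> block m y1 j) \<cdot>\<^sub>v ones_vec m)) \<and>
         (\<forall>j<n - 1. block m y3 j =
            (1 / real n) \<cdot>\<^sub>v (block m R3 j + finsum_vec TYPE(real) m (block m y1) {..<n})) \<and>
         block m y3 (n - 1) =
            (1 / real n) \<cdot>\<^sub>v (block m R3 (n - 1)
                             + Ibar m *\<^sub>v finsum_vec TYPE(real) m (block m y1) {..<n}) \<and>
         (\<forall>j<n. block m y1 j = yhat1 m n R1 R2 R3 j - yhat1_a m n R1 R2 R3)"
    if y: "y1 \<in> carrier_vec ?M" "y2 \<in> carrier_vec ?M" "y3 \<in> carrier_vec (?M - 1)" for y1 y2 y3
    unfolding closed_form[OF y] solution_blocks_iff[OF pos y R, symmetric] by blast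
  ultimately show ?thesis by blast
qed

end
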